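(* Let $\alpha$ be a simple ordered rational $k$-cone in $\mathbb{R}^n$. (1) If $i\in\{1,\ldots,k-1\}$, then for every $x\in\{1,\ldots,k-1\}$ $$\operatorname{lcos}_{x,k}(\pi_i-\alpha)=\begin{cases}\operatorname{lsin}_k\alpha-\operatorname{lcos}_{x,k}\alpha & \text{if } x=i,\\ \operatorname{lcos}_{x,k}\alpha & \text{otherwise.}\end{cases}$$ (2) If $i=k$, then for every $x\in\{1,\ldots,k-1\}$ $$\operatorname{lcos}_{x,k}(\pi_k-\alpha)=\operatorname{lsin}_k\alpha-\operatorname{lcos}_{x,k}\alpha .$$
   Context: An ordered rational $k$-cone $\alpha$ in $\mathbb{R}^n$ ($k\le n$) is given by a vertex $A_0\in\mathbb{Z}^n$ and an ordered tuple $(v_1,\ldots,v_k)$ of linearly independent primitive integer vectors (its edge vectors); as a set it is $\{A_0+\sum\lambda_iv_i:\lambda_i\ge0\}$. Let $\Gamma=\mathbb{Z}^n\cap\operatorname{span}_{\mathbb{R}}(v_1,\ldots,v_k)$. There is a unique $\mathbb{Z}$-basis $e_1,\ldots,e_k$ of $\Gamma$ such that $v_i=\sum_{j\le i}a_{j,i}e_j$ with $a_{i,i}>0$ and $0\le a_{j,i}<a_{i,i}$ for $j<i$. The upper triangular matrix $(a_{j,i})$ is denoted $\operatorname{IARCTAN}(\alpha)$ (the normalised Hermite normal form). The $i$-th integer sine is $\operatorname{lsin}_i\alpha=a_{i,i}$ and the $(j,i)$-th integer cosine ($j<i$) is $\operatorname{lcos}_{j,i}\alpha=a_{j,i}$.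 The integer sine of a rational $m$-cone $\beta$ with primitive edge vectors $w_1,\ldots,w_m$ is the index $\operatorname{lsin}(\beta)=[\mathbb{Z}^n\cap\operatorname{span}_{\mathbb{R}}(w_1,\ldots,w_m):\mathbb{Z}w_1+\cdots+\mathbb{Z}w_m]$. The cone $\alpha$ is simple if every $(k-1)$-dimensional face $\beta$ of $\alpha$ (the cone with vertex $A_0$ generated by $k-1$ of the vectors $v_i$) satisfies $\operatorname{lsin}(\beta)=1$. For $i\in\{1,\ldots,k\}$ the $i$-th adjacent cone $\pi_i-\alpha$ is the cone with the same vertex and ordered edge vectors $(v_1,\ldots,v_{i-1},-v_i,v_{i+1},\ldots,v_k)$.
   Formalization: The formula lsin_k α − lcos_{x,k} α (case x = i of (1), and all of (2)) is asserted only when lsin_k α ≠ 1; if lsin_k α = 1 both cosines are 0 and it would read 0 = 1, e.g. for edge vectors (1,0), (0,1). *)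

theory Defs
  imports "HOL-Analysis.Analysis"
begin

text \<open>The dimension \<open>n\<close> of the ambient space is the cardinality of the index type \<open>'n\<close>.
  Families of vectors, faces and matrix entries are numbered from 1, as in the literature.\<close>

datatype ('n::finite) ordered_cone =
  Ordered_Cone (vertex: "int ^ 'n") (edges: "(int ^ 'n) list")

definition real_vec :: "int ^ 'n \<Rightarrow> real ^ 'n" where
  "real_vec v = (\<chi> i. of_int (v $ i))"

definition primitive_vec :: "int ^ 'n \<Rightarrow> bool" where
  "primitive_vec v \<longleftrightarrow> Gcd (range (\<lambda>i. v $ i)) = 1"

definition edge :: "'n::finite ordered_cone \<Rightarrow> nat \<Rightarrow> int ^ 'n" where
  "edge \<alpha> i = edges \<alpha> ! (i - 1)"

text \<open>Linear independence of the tuple, as opposed to its set of entries, includes distinctness.\<close>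

definition ordered_rational_cone :: "nat \<Rightarrow> 'n::finite ordered_cone \<Rightarrow> bool" where
  "ordered_rational_cone k \<alpha> \<longleftrightarrow>
     length (edges \<alpha>) = k \<and>
     (\<forall>v \<in> set (edges \<alpha>). primitive_vec v) \<and>
     distinct (edges \<alpha>) \<and> independent (real_vec ` set (edges \<alpha>))"

definition cone_lattice :: "'n::finite ordered_cone \<Rightarrow> (int ^ 'n) set" where
  "cone_lattice \<alpha> = {x. real_vec x \<in> span (real_vec ` set (edges \<alpha>))}"

definition int_comb :: "nat \<Rightarrow> (nat \<Rightarrow> int) \<Rightarrow> (nat \<Rightarrow> int ^ 'n) \<Rightarrow> int ^ 'n" where
  "int_comb m c w = (\<Sum>i = 1..m. c i *s w i)"

definition int_span :: "nat \<Rightarrow> (nat \<Rightarrow> int ^ 'n) \<Rightarrow> (int ^ 'n) set" where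
  "int_span m w = {int_comb m c w | c. True}"

definition int_basis :: "nat \<Rightarrow> (nat \<Rightarrow> int ^ 'n) \<Rightarrow> (int ^ 'n) set \<Rightarrow> bool" where
  "int_basis m e \<Gamma> \<longleftrightarrow>
     int_span m e = \<Gamma> \<and> (\<forall>c. int_comb m c e = 0 \<longrightarrow> (\<forall>i \<in> {1..m}. c i = 0))"

text \<open>The index of a subgroup, as the number of its cosets; it is 0 if there are infinitely many.\<close>

definition lattice_index :: "(int ^ 'n) set \<Rightarrow> (int ^ 'n) set \<Rightarrow> nat" where
  "lattice_index \<Gamma> H = card (\<Gamma> // {(x, y). x \<in> \<Gamma> \<and> y \<in> \<Gamma> \<and> x - y \<in> H})"

definition cone_lsin :: "'n::finite ordered_cone \<Rightarrow> nat" where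
  "cone_lsin \<beta> = lattice_index (cone_lattice \<beta>) (int_span (length (edges \<beta>)) (edge \<beta>))"

text \<open>Matrices are functions of row and column index; the entries below the diagonal and outside
  the \<open>k \<times> k\<close> range are fixed to be 0, so that the normalised Hermite normal form is unique as a
  function.\<close>

definition is_iarctan :: "'n::finite ordered_cone \<Rightarrow> (nat \<Rightarrow> nat \<Rightarrow> int) \<Rightarrow> bool" where
  "is_iarctan \<alpha> a \<longleftrightarrow> (let k = length (edges \<alpha>) in
     \<exists>e. int_basis k e (cone_lattice \<alpha>) \<and>
         (\<forall>i \<in> {1..k}. edge \<alpha> i = (\<Sum>j = 1..i. a j i *s e j)) \<and>
         (\<forall>i \<in> {1..k}. 0 < a i i) \<and>
         (\<forall>i \<in> {1..k}. \<forall>j \<in> {1..<i}. 0 \<le> a j i \<and> a j i < a i i) \<and>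
         (\<forall>j i. \<not> (1 \<le> j \<and> j \<le> i \<and> i \<le> k) \<longrightarrow> a j i = 0))"

definition iarctan :: "'n::finite ordered_cone \<Rightarrow> nat \<Rightarrow> nat \<Rightarrow> int" where
  "iarctan \<alpha> = (THE a. is_iarctan \<alpha> a)"

definition lsin :: "nat \<Rightarrow> 'n::finite ordered_cone \<Rightarrow> int" where
  "lsin i \<alpha> = iarctan \<alpha> i i"

definition lcos :: "nat \<Rightarrow> nat \<Rightarrow> 'n::finite ordered_cone \<Rightarrow> int" where
  "lcos j i \<alpha> = iarctan \<alpha> j i"

definition facet :: "nat \<Rightarrow> 'n::finite ordered_cone \<Rightarrow> 'n ordered_cone" where
  "facet i \<alpha> = Ordered_Cone (vertex \<alpha>) (take (i - 1) (edges \<alpha>) @ drop i (edges \<alpha>))"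

definition simple_cone :: "'n::finite ordered_cone \<Rightarrow> bool" where
  "simple_cone \<alpha> \<longleftrightarrow> (\<forall>i \<in> {1..length (edges \<alpha>)}. cone_lsin (facet i \<alpha>) = 1)"

definition adjacent_cone :: "nat \<Rightarrow> 'n::finite ordered_cone \<Rightarrow> 'n ordered_cone" where
  "adjacent_cone i \<alpha> = Ordered_Cone (vertex \<alpha>) ((edges \<alpha>)[i - 1 := - edge \<alpha> i])"

end

(* Since the facet opposite to v_k has integer sine 1, a lattice point f minimising the v_k-coordinate
   among those where it is positive completes v_1, ..., v_{k-1} to a basis of the cone lattice.
   Write v_k = s f + sum_j b_j v_j. Shearing f by the quotients b_j div s gives the Hermite normal
   form, so its last column is (b_j mod s)_j followed by s. Reversing v_i (i < k) negates b_i only,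
   and reversing v_k negates f and all b_j, so the cosines concerned become (- b_j) mod s, which is
   s - (b_j mod s) unless s divides b_j. If s divides b_j, then f + (b_j / s) v_j lies in the span
   of the facet without v_j, and integer sine 1 of that facet forces s = 1. *)

theory Submission
  imports Defs
begin

section \<open>Integer vectors and integer combinations\<close>

lemma real_vec_simps:
  "real_vec (x + y) = real_vec x + real_vec y"
  "real_vec (x - y) = real_vec x - real_vec y"
  "real_vec (- x) = - real_vec x"
  "real_vec (c *s x) = of_int c *\<^sub>R real_vec x"
  "real_vec 0 = 0"
  by (simp_all add: real_vec_def vec_eq_iff)

lemma real_vec_sum: "real_vec (\<Sum>i\<in>A. f i) = (\<Sum>i\<in>A. real_vec (f i))"
  by (induction A rule: infinite_finite_induct) (simp_all add: real_vec_simps)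

text \<open>A norm bound confines each coordinate to a finite interval of integers. This
  discreteness is why the minimum in \<open>simple_cone_basis\<close> exists.\<close>

lemma finite_bounded_int_vecs: "finite {x :: int ^ 'n::finite. norm (real_vec x) \<le> M}"
proof -
  have "{x :: int ^ 'n. norm (real_vec x) \<le> M} \<subseteq>
        vec_lambda ` (\<Pi>\<^sub>E i\<in>UNIV. {- \<lceil>M\<rceil>..\<lceil>M\<rceil>})"
  proof
    fix x :: "int ^ 'n" assume "x \<in> {x. norm (real_vec x) \<le> M}"
    then have "\<bar>real_of_int (x $ i)\<bar> \<le> M" for i
      using component_le_norm_cart[of "real_vec x" i] by (simp add: real_vec_def)
    then have "x $ i \<in> {- \<lceil>M\<rceil>..\<lceil>M\<rceil>}" for i
      by (smt (verit) atLeastAtMost_iff le_of_int_ceiling of_int_le_iff of_int_minus)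
    then have "vec_nth x \<in> (\<Pi>\<^sub>E i\<in>UNIV. {- \<lceil>M\<rceil>..\<lceil>M\<rceil>})"
      by auto
    then show "x \<in> vec_lambda ` (\<Pi>\<^sub>E i\<in>UNIV. {- \<lceil>M\<rceil>..\<lceil>M\<rceil>})"
      by (metis image_eqI vec_nth_inverse)
  qed
  then show ?thesis
    by (rule finite_subset) (intro finite_imageI finite_PiE; simp)
qed

lemma int_basis_unique_coeffs:
  assumes "int_basis m e \<Gamma>" and "int_comb m c e = int_comb m d e" and "i \<in> {1..m}"
  shows "c i = d i"
proof -
  have "int_comb m (\<lambda>i. c i - d i) e = 0"
    using assms(2) by (simp add: int_comb_def vector_sub_rdistrib sum_subtractf)
  then show ?thesis using assms(1,3) unfolding int_basis_def by fastforce
qed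

text \<open>Padding with zero coefficients turns a partial sum into a full \<open>int_comb\<close>,
  the form in which coefficients over a basis can be compared.\<close>

lemma int_comb_if_mem:
  assumes "S \<subseteq> {1..m}"
  shows "int_comb m (\<lambda>j. if j \<in> S then c j else 0) e = (\<Sum>j\<in>S. c j *s e j)"
  unfolding int_comb_def using assms by (intro sum.mono_neutral_cong_right) auto

lemma int_comb_single:
  "i \<in> {1..m} \<Longrightarrow> int_comb m (\<lambda>j. if j = i then c else 0) e = c *s e i"
  using int_comb_if_mem[of "{i}" m "\<lambda>_. c" e] by simp

text \<open>Comparing whole terms, not coefficients and vectors separately, allows a sign to move
  from a vector to its coefficient.\<close>

lemma int_comb_cong:
  "(\<And>j. j \<in> {1..m} \<Longrightarrow> c j *s e j = c' j *s e' j) \<Longrightarrow> int_comb m c e = int_comb m c' e'"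
  by (simp add: int_comb_def)

lemma int_comb_add: "int_comb m c e + int_comb m d e = int_comb m (\<lambda>j. c j + d j) e"
  by (simp add: int_comb_def sum.distrib vector_sadd_rdistrib)

lemma int_comb_Suc: "int_comb (Suc m) c e = int_comb m c e + c (Suc m) *s e (Suc m)"
  by (simp add: int_comb_def)

lemma int_comb_scale: "r *s int_comb m c e = int_comb m (\<lambda>j. r * c j) e"
  by (induction m) (simp_all add: int_comb_def vector_add_ldistrib vector_smult_assoc)

section \<open>Uniqueness of the Hermite normal form\<close>

text \<open>Expanding each of \<open>e i\<close>, \<open>e' i\<close> in the other basis shows that
  the positive diagonal entries divide each other, so they agree. The entries above them are then
  congruent modulo the common diagonal entry and reduced, hence equal, and the expansion of
  \<open>e' i\<close> collapses to \<open>e i\<close>.\<close>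

lemma hermite_column_unique:
  assumes e: "int_basis m e \<Gamma>" and e': "int_basis m e' \<Gamma>" and i: "i \<in> {1..m}"
    and eq: "(\<Sum>j = 1..i. a j *s e j) = (\<Sum>j = 1..i. a' j *s e' j)"
    and prev: "\<And>j. j \<in> {1..<i} \<Longrightarrow> e j = e' j"
    and pos: "0 < a i" "0 < a' i"
    and red: "\<And>j. j \<in> {1..<i} \<Longrightarrow> 0 \<le> a j \<and> a j < a i"
      "\<And>j. j \<in> {1..<i} \<Longrightarrow> 0 \<le> a' j \<and> a' j < a' i"
  shows "e i = e' i \<and> (\<forall>j \<in> {1..i}. a j = a' j)"
proof -
  \<comment> \<open>Stated for arbitrary bases and columns because it is applied in both directions,
    once for each divisibility.\<close>
  have transfer: "\<exists>c. e' i = int_comb m c e \<and> (\<forall>j \<in> {1..m}. (if j \<in> {1..i} then a j else 0) =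
         a' i * c j + (if j \<in> {1..<i} then a' j else 0))"
    if e: "int_basis m e \<Gamma>" and e': "int_basis m e' \<Gamma>"
      and eq: "(\<Sum>j = 1..i. a j *s e j) = (\<Sum>j = 1..i. a' j *s e' j)"
      and prev: "\<And>j. j \<in> {1..<i} \<Longrightarrow> e j = e' j"
    for e e' and a a' :: "nat \<Rightarrow> int"
  proof -
    have "e' i = int_comb m (\<lambda>j. if j = i then 1 else 0) e'"
      using i by (simp add: int_comb_single)
    then have "e' i \<in> \<Gamma>" using e' unfolding int_basis_def int_span_def by auto
    then obtain c where c: "e' i = int_comb m c e"
      using e unfolding int_basis_def int_span_def by auto
    have split: "{1..i} = insert i {1..<i}" using i by auto
    have "int_comb m (\<lambda>j. if j \<in> {1..i} then a j else 0) e = (\<Sum>j = 1..i. a' j *s e' j)"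
      using i eq by (subst int_comb_if_mem) auto
    also have "\<dots> = a' i *s e' i + (\<Sum>j = 1..<i. a' j *s e j)"
      unfolding split using prev by simp
    also have "(\<Sum>j = 1..<i. a' j *s e j) = int_comb m (\<lambda>j. if j \<in> {1..<i} then a' j else 0) e"
      using i by (subst int_comb_if_mem) auto
    also have "a' i *s e' i + \<dots> =
        int_comb m (\<lambda>j. a' i * c j + (if j \<in> {1..<i} then a' j else 0)) e"
      unfolding c int_comb_scale int_comb_add ..
    finally show ?thesis
      using int_basis_unique_coeffs[OF e] c by blast
  qed
  obtain c where c: "e' i = int_comb m c e"
    and cj: "\<And>j. j \<in> {1..m} \<Longrightarrow>
      (if j \<in> {1..i} then a j else 0) = a' i * c j + (if j \<in> {1..<i} then a' j else 0)"
    using transfer[OF e e' eq prev] by blast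
  obtain d where dj: "\<And>j. j \<in> {1..m} \<Longrightarrow>
      (if j \<in> {1..i} then a' j else 0) = a i * d j + (if j \<in> {1..<i} then a j else 0)"
    using transfer[OF e' e eq[symmetric] prev[symmetric]] by blast
  have "a i = a' i * c i" "a' i = a i * d i"
    using cj[OF i] dj[OF i] i by simp_all
  then have "a' i dvd a i" "a i dvd a' i" by (metis dvdI)+
  then have ai: "a i = a' i" using pos by (simp add: zdvd_antisym_nonneg)
  have ci: "c i = 1" using cj[OF i] i ai pos by auto
  have low: "c j = 0 \<and> a j = a' j" if j: "j \<in> {1..<i}" for j
  proof -
    have eq: "a j = a' i * c j + a' j" using cj[of j] i j by auto
    then have "a j mod a' i = a' j mod a' i" by simp
    then have "a j = a' j" using red[OF j] ai by simp
    then show ?thesis using eq pos by simp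
  qed
  \<comment> \<open>Beyond row \<open>i\<close> both columns are padded with 0, which leaves
    \<open>a' i * c j = 0\<close>.\<close>
  have high: "c j = 0" if "j \<in> {1..m}" "i < j" for j
    using cj[of j] that pos by auto
  have "e' i = int_comb m (\<lambda>j. if j = i then 1 else 0) e"
    unfolding c int_comb_def
  proof (intro sum.cong refl)
    fix j assume "j \<in> {1..m}"
    then show "c j *s e j = (if j = i then 1 else 0) *s e j"
      using ci low[of j] high[of j] by (cases "j < i"; cases "j = i") auto
  qed
  also have "\<dots> = e i"
    using i by (simp add: int_comb_single)
  finally have "e i = e' i" by simp
  moreover have "a j = a' j" if "j \<in> {1..i}" for j
    using low[of j] ai that by (cases "j = i") auto
  ultimately show ?thesis by blast
qed

text \<open>The two normal forms may come from different bases, so the induction over columns proves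
  equality of basis vectors along with that of entries. Outside the triangle both matrices are 0 by
  convention.\<close>

lemma is_iarctan_unique:
  assumes "is_iarctan \<alpha> a" and "is_iarctan \<alpha> a'"
  shows "a = a'"
proof -
  define k where "k = length (edges \<alpha>)"
  obtain e where e: "int_basis k e (cone_lattice \<alpha>)"
    and ee: "\<forall>i \<in> {1..k}. edge \<alpha> i = (\<Sum>j = 1..i. a j i *s e j)"
    and ep: "\<forall>i \<in> {1..k}. 0 < a i i"
    and er: "\<forall>i \<in> {1..k}. \<forall>j \<in> {1..<i}. 0 \<le> a j i \<and> a j i < a i i"
    and ez: "\<forall>j i. \<not> (1 \<le> j \<and> j \<le> i \<and> i \<le> k) \<longrightarrow> a j i = 0"
    using assms(1) unfolding is_iarctan_def Let_def k_def by (elim exE conjE)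
  obtain e' where e': "int_basis k e' (cone_lattice \<alpha>)"
    and ee': "\<forall>i \<in> {1..k}. edge \<alpha> i = (\<Sum>j = 1..i. a' j i *s e' j)"
    and ep': "\<forall>i \<in> {1..k}. 0 < a' i i"
    and er': "\<forall>i \<in> {1..k}. \<forall>j \<in> {1..<i}. 0 \<le> a' j i \<and> a' j i < a' i i"
    and ez': "\<forall>j i. \<not> (1 \<le> j \<and> j \<le> i \<and> i \<le> k) \<longrightarrow> a' j i = 0"
    using assms(2) unfolding is_iarctan_def Let_def k_def by (elim exE conjE)
  have col: "i \<in> {1..k} \<Longrightarrow> e i = e' i \<and> (\<forall>j \<in> {1..i}. a j i = a' j i)" for i
  proof (induction i rule: less_induct)
    case (less i)
    then show ?case
      by (intro hermite_column_unique[OF e e', where a = "\<lambda>j. a j i" and a' = "\<lambda>j. a' j i"])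
        (use ee ee' ep ep' er er' in auto)
  qed
  have "a j i = a' j i" for j i
    using col[of i] ez[rule_format, of j i] ez'[rule_format, of j i] by (cases "1 \<le> j \<and> j \<le> i \<and> i \<le> k") auto
  then show ?thesis by blast
qed

lemma iarctan_eqI: "is_iarctan \<alpha> a \<Longrightarrow> iarctan \<alpha> = a"
  unfolding iarctan_def using is_iarctan_unique by blast

section \<open>Changing a lattice basis by signs and a shear\<close>

lemma int_comb_fun_upd:
  "int_comb (Suc m) (c(Suc m := a)) (e(Suc m := f)) = a *s f + int_comb m c e"
proof -
  have "int_comb m (c(Suc m := a)) (e(Suc m := f)) = int_comb m c e"
    by (rule int_comb_cong) auto
  then show ?thesis by (simp add: int_comb_Suc)
qed

text \<open>The transition matrix is triangular with diagonal entries 1 or -1, hence unimodular.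
  Trivial signs give the Hermite reduction of the last vector; \<open>q = 0\<close> gives the sign
  changes of an adjacent cone.\<close>

lemma int_basis_shear:
  assumes e: "int_basis (Suc m) e \<Gamma>"
    and \<epsilon>: "\<And>j. \<epsilon> j * \<epsilon> j = 1"
    and low: "\<And>j. j \<in> {1..m} \<Longrightarrow> e' j = \<epsilon> j *s e j"
    and top: "e' (Suc m) = \<epsilon> (Suc m) *s e (Suc m) + int_comb m q e"
  shows "int_basis (Suc m) e' \<Gamma>"
proof -
  \<comment> \<open>\<open>T\<close> converts coordinates with respect to \<open>e'\<close> into
    coordinates with respect to \<open>e\<close>.\<close>
  define T where "T c j = (if j = Suc m then \<epsilon> j * c j else \<epsilon> j * c j + c (Suc m) * q j)" for c j
  have T: "int_comb (Suc m) c e' = int_comb (Suc m) (T c) e" for c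
  proof -
    have "int_comb m c e' = int_comb m (\<lambda>j. c j * \<epsilon> j) e"
      by (rule int_comb_cong) (simp add: low vector_smult_assoc)
    moreover have "int_comb m (T c) e = int_comb m (\<lambda>j. c j * \<epsilon> j + c (Suc m) * q j) e"
      by (rule int_comb_cong) (auto simp: T_def mult.commute)
    moreover have "T c (Suc m) = c (Suc m) * \<epsilon> (Suc m)" by (simp add: T_def)
    ultimately show ?thesis
      unfolding int_comb_Suc top vector_add_ldistrib vector_smult_assoc int_comb_scale
        int_comb_add[symmetric] by simp
  qed
  have "\<exists>c. T c = d" for d
  proof
    have invol: "\<epsilon> j * (\<epsilon> j * x) = x" for j x
      by (metis \<epsilon> mult.assoc mult_1)
    \<comment> \<open>The preimage is found by back substitution: the top coordinate is only changed
      by a sign, and its contribution is subtracted from the others.\<close>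
    show "T (\<lambda>j. if j = Suc m then \<epsilon> j * d j
        else \<epsilon> j * (d j - \<epsilon> (Suc m) * d (Suc m) * q j)) = d"
      unfolding T_def by (intro ext) (simp add: invol)
  qed
  then have "int_span (Suc m) e' = int_span (Suc m) e"
    unfolding int_span_def T by (metis (no_types))
  moreover have "\<forall>i \<in> {1..Suc m}. c i = 0" if "int_comb (Suc m) c e' = 0" for c
  proof -
    have z: "\<forall>i \<in> {1..Suc m}. T c i = 0"
      using e that unfolding T int_basis_def by blast
    have nz: "\<epsilon> j \<noteq> 0" for j using \<epsilon>[of j] by auto
    from z nz have "c (Suc m) = 0" by (force simp: T_def)
    show ?thesis
    proof
      fix i assume "i \<in> {1..Suc m}"
      then have "T c i = 0" using z by blast
      then show "c i = 0" using \<open>c (Suc m) = 0\<close> nz[of i] by (auto simp: T_def split: if_splits)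
    qed
  qed
  ultimately show ?thesis using e unfolding int_basis_def by simp
qed

section \<open>Edges, dual functionals and facets\<close>

lemma set_edges: "length (edges \<alpha>) = k \<Longrightarrow> set (edges \<alpha>) = edge \<alpha> ` {1..k}"
proof -
  assume k: "length (edges \<alpha>) = k"
  have "edge \<alpha> ` {1..k} = edge \<alpha> ` Suc ` {..<k}"
    by (simp add: image_Suc_lessThan)
  then show ?thesis
    unfolding image_image by (auto simp: edge_def set_conv_nth k image_iff)
qed

lemma edge_independent:
  fixes \<alpha> :: "'n::finite ordered_cone"
  assumes "ordered_rational_cone k \<alpha>"
  shows "inj_on (\<lambda>j. real_vec (edge \<alpha> j)) {1..k}"
    and "independent ((\<lambda>j. real_vec (edge \<alpha> j)) ` {1..k})"
proof -
  have len: "length (edges \<alpha>) = k" and dist: "distinct (edges \<alpha>)"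
    and indep: "independent (real_vec ` set (edges \<alpha>))"
    using assms unfolding ordered_rational_cone_def by auto
  show "independent ((\<lambda>j. real_vec (edge \<alpha> j)) ` {1..k})"
    using indep unfolding set_edges[OF len] image_image .
  have "inj (real_vec :: int ^ 'n \<Rightarrow> real ^ 'n)"
    by (auto simp: inj_def real_vec_def vec_eq_iff)
  moreover have "inj_on (edge \<alpha>) {1..k}"
  proof (rule inj_onI)
    fix i j assume ij: "i \<in> {1..k}" "j \<in> {1..k}" and "edge \<alpha> i = edge \<alpha> j"
    then have "i - 1 = j - 1"
      using nth_eq_iff_index_eq[OF dist, of "i - 1" "j - 1"] len unfolding edge_def by force
    then show "i = j" using ij by auto
  qed
  ultimately show "inj_on (\<lambda>j. real_vec (edge \<alpha> j)) {1..k}"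
    unfolding inj_on_def by blast
qed

text \<open>Independence lets values on the edges be prescribed; injectivity of the numbering
  guarantees that the value 1 is assigned at index \<open>i\<close> alone.\<close>

lemma dual_functional:
  assumes "ordered_rational_cone k \<alpha>" and "i \<in> {1..k}"
  obtains \<tau> :: "real ^ 'n \<Rightarrow> real" where "linear \<tau>" "\<tau> (real_vec (edge \<alpha> i)) = 1"
    "\<And>j. j \<in> {1..k} - {i} \<Longrightarrow> \<tau> (real_vec (edge (\<alpha> :: 'n::finite ordered_cone) j)) = 0"
proof -
  let ?V = "\<lambda>j. real_vec (edge \<alpha> j)"
  have "\<exists>\<tau> :: real ^ 'n \<Rightarrow> real. linear \<tau> \<and>
      (\<forall>x \<in> ?V ` {1..k}. \<tau> x = (if x = ?V i then 1 else 0))"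
    by (rule linear_independent_extend[OF edge_independent(2)[OF assms(1)]])
  then obtain \<tau> :: "real ^ 'n \<Rightarrow> real" where "linear \<tau>"
    and \<tau>: "\<forall>x \<in> ?V ` {1..k}. \<tau> x = (if x = ?V i then 1 else 0)"
    by (elim exE conjE)
  moreover have "\<tau> (?V i) = 1" using \<tau> assms(2) by auto
  moreover have "\<tau> (?V j) = 0" if j: "j \<in> {1..k} - {i}" for j
  proof -
    have "?V j \<noteq> ?V i"
      using edge_independent(1)[OF assms(1)] assms(2) j unfolding inj_on_def by blast
    then show ?thesis using \<tau> j by auto
  qed
  ultimately show ?thesis using that by blast
qed

text \<open>With a single coset, \<open>x\<close> and 0 have the same class, which puts
  \<open>0 - x\<close> into \<open>H\<close>.\<close>

lemma lattice_index_eq_1D: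
  assumes "lattice_index \<Gamma> H = 1" and "0 \<in> H" and "0 \<in> \<Gamma>"
    and "\<And>x. x \<in> H \<Longrightarrow> - x \<in> H" and "x \<in> \<Gamma>"
  shows "x \<in> H"
proof -
  let ?R = "{(x, y). x \<in> \<Gamma> \<and> y \<in> \<Gamma> \<and> x - y \<in> H}"
  obtain X where "\<Gamma> // ?R = {X}"
    using assms(1) unfolding lattice_index_def by (auto simp: card_1_singleton_iff)
  then have "?R `` {x} = ?R `` {0}"
    using assms(3,5) quotientI[of x \<Gamma> ?R] quotientI[of 0 \<Gamma> ?R] by simp
  moreover have "x \<in> ?R `` {x}" using assms(2,5) by simp
  ultimately have "- x \<in> H" by simp
  then show ?thesis using assms(4) by fastforce
qed

lemma edge_facet:
  assumes "length (edges \<alpha>) = k" and "i \<in> {1..k}" and "j \<in> {1..k - 1}"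
  shows "edge (facet i \<alpha>) j = edge \<alpha> (if j < i then j else j + 1)"
  using assms by (auto simp: facet_def edge_def nth_append min_def)

lemma length_facet:
  assumes "length (edges \<alpha>) = k" and "i \<in> {1..k}"
  shows "length (edges (facet i \<alpha>)) = k - 1"
  using assms by (auto simp: facet_def)

text \<open>Deleting edge \<open>i\<close> shifts the later numbers down by one; undoing the shift
  lets facet sums use the numbering of the whole cone.\<close>

lemma int_comb_facet:
  assumes "length (edges \<alpha>) = k" and "i \<in> {1..k}"
  shows "int_comb (k - 1) c (edge (facet i \<alpha>)) =
         (\<Sum>j \<in> {1..k} - {i}. c (if j < i then j else j - 1) *s edge \<alpha> j)"
  unfolding int_comb_def
  by (rule sum.reindex_bij_witness[where i = "\<lambda>j. if j < i then j else j - 1"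
        and j = "\<lambda>j. if j < i then j else j + 1"])
    (use assms in \<open>auto simp: edge_facet[OF assms] split: if_splits\<close>)

lemma edges_facet_image:
  assumes "length (edges \<alpha>) = k" and "i \<in> {1..k}"
  shows "set (edges (facet i \<alpha>)) = edge \<alpha> ` ({1..k} - {i})"
proof -
  have "set (edges (facet i \<alpha>)) = edge (facet i \<alpha>) ` {1..k - 1}"
    by (rule set_edges[OF length_facet[OF assms]])
  also have "\<dots> = edge \<alpha> ` (\<lambda>j. if j < i then j else j + 1) ` {1..k - 1}"
    unfolding image_image by (rule image_cong[OF refl edge_facet[OF assms]])
  also have "(\<lambda>j. if j < i then j else j + 1) ` {1..k - 1} = {1..k} - {i}"
  proof (intro equalityI subsetI)
    fix j assume "j \<in> {1..k} - {i}"
    then show "j \<in> (\<lambda>j. if j < i then j else j + 1) ` {1..k - 1}"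
      using assms(2) by (intro image_eqI[where x = "if j < i then j else j - 1"]) auto
  qed (use assms(2) in \<open>auto split: if_splits\<close>)
  finally show ?thesis .
qed

text \<open>Integer sine 1 means that the edges of a facet generate every lattice point of their
  real span. Simplicity enters the later arguments in this form.\<close>

lemma simple_cone_facet:
  assumes "ordered_rational_cone k \<alpha>" and "simple_cone \<alpha>" and i: "i \<in> {1..k}"
    and y: "real_vec y \<in> span ((\<lambda>j. real_vec (edge \<alpha> j)) ` ({1..k} - {i}))"
  obtains c where "y = (\<Sum>j \<in> {1..k} - {i}. c j *s edge \<alpha> j)"
proof -
  have len: "length (edges \<alpha>) = k"
    using assms(1) unfolding ordered_rational_cone_def by simp
  let ?H = "int_span (k - 1) (edge (facet i \<alpha>))"
  have one: "lattice_index (cone_lattice (facet i \<alpha>)) ?H = 1"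
    using bspec[OF assms(2)[unfolded simple_cone_def len] i] length_facet[OF len i]
    by (simp add: cone_lsin_def)
  have "y \<in> cone_lattice (facet i \<alpha>)"
    using y unfolding cone_lattice_def edges_facet_image[OF len i] image_image by simp
  moreover have "0 \<in> ?H"
    unfolding int_span_def by (auto simp: int_comb_def intro: exI[of _ "\<lambda>_. 0"])
  moreover have "- x \<in> ?H" if "x \<in> ?H" for x
    using that unfolding int_span_def vector_sneg_minus1[of x] by (auto simp: int_comb_scale)
  moreover have "0 \<in> cone_lattice (facet i \<alpha>)"
    by (simp add: cone_lattice_def real_vec_simps span_zero)
  ultimately have "y \<in> ?H" using lattice_index_eq_1D[OF one] by blast
  then obtain c where "y = int_comb (k - 1) c (edge (facet i \<alpha>))"
    unfolding int_span_def by blast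
  then show ?thesis using that[of "\<lambda>j. c (if j < i then j else j - 1)"]
    unfolding int_comb_facet[OF len i] by blast
qed

section \<open>A lattice basis containing all edges but the last\<close>

lemma cone_lattice_eq:
  "length (edges \<alpha>) = k \<Longrightarrow>
    cone_lattice \<alpha> = {x. real_vec x \<in> span ((\<lambda>j. real_vec (edge \<alpha> j)) ` {1..k})}"
  by (simp add: cone_lattice_def set_edges image_image)

lemma cone_lattice_closed:
  "x \<in> cone_lattice \<alpha> \<Longrightarrow> y \<in> cone_lattice \<alpha> \<Longrightarrow> x - y \<in> cone_lattice \<alpha>"
  "x \<in> cone_lattice \<alpha> \<Longrightarrow> c *s x \<in> cone_lattice \<alpha>"
  by (simp_all add: cone_lattice_def real_vec_simps span_diff span_scale)

lemma int_comb_in_cone_lattice: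
  assumes "\<And>j. j \<in> {1..m} \<Longrightarrow> e j \<in> cone_lattice \<alpha>"
  shows "int_comb m c e \<in> cone_lattice \<alpha>"
  using assms unfolding cone_lattice_def int_comb_def
  by (auto simp: real_vec_sum real_vec_simps intro!: span_sum span_scale)

lemma edge_in_cone_lattice:
  assumes "length (edges \<alpha>) = k" and "j \<in> {1..k}"
  shows "edge \<alpha> j \<in> cone_lattice \<alpha>"
  using assms by (auto simp: cone_lattice_eq intro: span_base)

text \<open>Subtracting the integer parts of the coordinates along the first \<open>m\<close> edges confines the
  minimisation of \<open>\<tau>\<close> over the lattice to a bounded, hence finite, set of integer points.\<close>

lemma fundamental_domain_translate:
  fixes \<alpha> :: "'n::finite ordered_cone" and \<tau> :: "real ^ 'n \<Rightarrow> real"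
  assumes len: "length (edges \<alpha>) = Suc m"
    and lin: "linear \<tau>" and \<tau>1: "\<tau> (real_vec (edge \<alpha> (Suc m))) = 1"
    and \<tau>0: "\<And>j. j \<in> {1..m} \<Longrightarrow> \<tau> (real_vec (edge \<alpha> j)) = 0"
    and y: "y \<in> cone_lattice \<alpha>" and bounds: "0 \<le> \<tau> (real_vec y)" "\<tau> (real_vec y) \<le> 1"
  obtains z where "z \<in> cone_lattice \<alpha>" "\<tau> (real_vec z) = \<tau> (real_vec y)"
    "norm (real_vec z) \<le> (\<Sum>j = 1..Suc m. norm (real_vec (edge \<alpha> j)))"
proof -
  let ?V = "\<lambda>j. real_vec (edge \<alpha> j)"
  have \<tau>_sum: "\<tau> (\<Sum>j = 1..m. t j *\<^sub>R ?V j) = 0" for t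
    unfolding linear_sum[OF lin] by (intro sum.neutral ballI) (simp add: linear_cmul[OF lin] \<tau>0)
  have "real_vec y \<in> span (?V ` {1..Suc m})"
    using y by (simp add: cone_lattice_eq[OF len])
  then have "\<exists>t. real_vec y = (\<Sum>j\<in>{1..Suc m}. t j *\<^sub>R ?V j)"
  proof (induction rule: span_induct_alt)
    case base
    show ?case by (rule exI[of _ "\<lambda>_. 0"]) simp
  next
    case (step c x y)
    then obtain i t where i: "i \<in> {1..Suc m}" "x = ?V i"
      and t: "y = (\<Sum>j\<in>{1..Suc m}. t j *\<^sub>R ?V j)" by blast
    have "(\<Sum>j\<in>{1..Suc m}. (if j = i then c else 0) *\<^sub>R ?V j) = c *\<^sub>R x"
      using i by (simp add: if_distrib[of "\<lambda>c. c *\<^sub>R _"] cong: if_cong)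
    then have "c *\<^sub>R x + y = (\<Sum>j\<in>{1..Suc m}. (t j + (if j = i then c else 0)) *\<^sub>R ?V j)"
      unfolding t scaleR_add_left sum.distrib by simp
    then show ?case by (intro exI[of _ "\<lambda>j. t j + (if j = i then c else 0)"])
  qed
  then obtain t where "real_vec y = (\<Sum>j\<in>{1..Suc m}. t j *\<^sub>R ?V j)" by (elim exE)
  then have t: "real_vec y = (\<Sum>j = 1..m. t j *\<^sub>R ?V j) + t (Suc m) *\<^sub>R ?V (Suc m)"
    by simp
  have tk: "\<tau> (real_vec y) = t (Suc m)"
    unfolding t by (simp add: linear_add[OF lin] \<tau>_sum linear_cmul[OF lin] \<tau>1 del: One_nat_def)
  define z where "z = y - int_comb m (\<lambda>j. \<lfloor>t j\<rfloor>) (edge \<alpha>)"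
  have zV: "real_vec z = (\<Sum>j = 1..m. frac (t j) *\<^sub>R ?V j) + t (Suc m) *\<^sub>R ?V (Suc m)"
    by (simp add: z_def int_comb_def real_vec_simps real_vec_sum t frac_def scaleR_diff_left
        sum_subtractf)
  have "norm (real_vec z) \<le> (\<Sum>j = 1..m. norm (frac (t j) *\<^sub>R ?V j)) + norm (t (Suc m) *\<^sub>R ?V (Suc m))"
    unfolding zV by (intro norm_triangle_le add_mono norm_sum order_refl)
  also have "\<dots> \<le> (\<Sum>j = 1..m. norm (?V j)) + norm (?V (Suc m))"
  \<comment> \<open>No coefficient exceeds 1 in absolute value: the first \<open>m\<close> are
    fractional parts, and the last is the value of \<open>\<tau>\<close>, bounded by
    assumption.\<close>
  proof (intro add_mono sum_mono)
    show "norm (frac (t j) *\<^sub>R ?V j) \<le> norm (?V j)" for j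
      using frac_lt_1[of "t j"] by (simp add: mult_left_le_one_le)
    show "norm (t (Suc m) *\<^sub>R ?V (Suc m)) \<le> norm (?V (Suc m))"
      using bounds unfolding tk by (simp add: mult_left_le_one_le)
  qed
  also have "\<dots> = (\<Sum>j = 1..Suc m. norm (?V j))" by simp
  finally have "norm (real_vec z) \<le> (\<Sum>j = 1..Suc m. norm (?V j))" .
  moreover have "\<tau> (real_vec z) = \<tau> (real_vec y)"
    unfolding tk zV by (simp add: linear_add[OF lin] \<tau>_sum linear_cmul[OF lin] \<tau>1 del: One_nat_def)
  moreover have "z \<in> cone_lattice \<alpha>"
    unfolding z_def by (intro cone_lattice_closed int_comb_in_cone_lattice y
        edge_in_cone_lattice[OF len]) simp
  ultimately show ?thesis using that by blast
qed

text \<open>The functional dual to the last edge acts as a height. Lattice points of height 0 are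
  integer combinations of the first \<open>m\<close> edges by simplicity, and division with
  remainder by the least positive height reduces every lattice point to height 0.\<close>

lemma simple_cone_basis:
  assumes cone: "ordered_rational_cone (Suc m) \<alpha>" and simple: "simple_cone \<alpha>"
  obtains f s b where "int_basis (Suc m) ((edge \<alpha>)(Suc m := f)) (cone_lattice \<alpha>)" "0 < s"
    "edge \<alpha> (Suc m) = s *s f + int_comb m b (edge \<alpha>)"
proof -
  let ?V = "\<lambda>j. real_vec (edge \<alpha> j)" and ?\<Gamma> = "cone_lattice \<alpha>"
  have len: "length (edges \<alpha>) = Suc m"
    using cone unfolding ordered_rational_cone_def by simp
  have last: "Suc m \<in> {1..Suc m}" by simp
  have others: "{1..Suc m} - {Suc m} = {1..m}" by auto
  obtain \<tau>' where lin': "linear \<tau>'" and \<tau>'1: "\<tau>' (?V (Suc m)) = (1 :: real)"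
    and \<tau>'0: "\<And>j. j \<in> {1..m} \<Longrightarrow> \<tau>' (?V j) = 0"
    using dual_functional[OF cone last] unfolding others by metis
  define \<tau> where "\<tau> x = \<tau>' (real_vec x)" for x
  have \<tau>_simps: "\<tau> (x + y) = \<tau> x + \<tau> y" "\<tau> (x - y) = \<tau> x - \<tau> y" "\<tau> (c *s x) = of_int c * \<tau> x"
    for x y c
    by (simp_all add: \<tau>_def real_vec_simps linear_add[OF lin'] linear_diff[OF lin']
        linear_cmul[OF lin'])
  have \<tau>1: "\<tau> (edge \<alpha> (Suc m)) = 1" by (simp add: \<tau>_def \<tau>'1)
  have \<tau>0: "\<tau> (int_comb m c (edge \<alpha>)) = 0" for c
    by (simp add: \<tau>_def int_comb_def real_vec_sum real_vec_simps linear_sum[OF lin']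
        linear_cmul[OF lin'] \<tau>'0)
  have ker: "\<exists>c. y = int_comb m c (edge \<alpha>)" if y: "y \<in> ?\<Gamma>" "\<tau> y = 0" for y
  proof -
    have "real_vec y \<in> span (insert (?V (Suc m)) (?V ` {1..m}))"
      using y(1) unfolding cone_lattice_eq[OF len] by (simp add: atLeastAtMostSuc_conv)
    then obtain t where t: "real_vec y - t *\<^sub>R ?V (Suc m) \<in> span (?V ` {1..m})"
      unfolding span_breakdown_eq by blast
    then have "\<tau>' (real_vec y - t *\<^sub>R ?V (Suc m)) = 0"
      by (rule linear_eq_0_on_span[OF lin', rotated]) (auto simp: \<tau>'0)
    then have "t = 0"
      using y(2) by (simp add: \<tau>_def linear_diff[OF lin'] linear_cmul[OF lin'] \<tau>'1)
    then show ?thesis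
      using simple_cone_facet[OF cone simple last, of y] t
      unfolding others int_comb_def by auto
  qed
  \<comment> \<open>The norm bound makes \<open>G\<close> finite, and the last edge, of height 1,
    makes it nonempty.\<close>
  define G where "G = {y \<in> ?\<Gamma>. 0 < \<tau> y \<and> \<tau> y \<le> 1 \<and>
      norm (real_vec y) \<le> (\<Sum>j = 1..Suc m. norm (?V j))}"
  have "finite G"
    unfolding G_def by (rule finite_subset[OF _ finite_bounded_int_vecs]) blast
  moreover have "edge \<alpha> (Suc m) \<in> G"
    using edge_in_cone_lattice[OF len last] \<tau>1 by (simp add: G_def sum_nonneg)
  ultimately have "Min (\<tau> ` G) \<in> \<tau> ` G" and Min: "\<And>y. y \<in> G \<Longrightarrow> Min (\<tau> ` G) \<le> \<tau> y"
    by (auto intro!: Min_in)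
  then obtain f where f: "f \<in> G" "\<tau> f = Min (\<tau> ` G)" by auto
  have f\<Gamma>: "f \<in> ?\<Gamma>" and fpos: "0 < \<tau> f" and f1: "\<tau> f \<le> 1"
    using f(1) unfolding G_def by auto
  \<comment> \<open>Minimality extends from \<open>G\<close> to the lattice: a point of height at
    most 1 has a translate in \<open>G\<close> of the same height, and \<open>\<tau> f\<close> is
    itself at most 1.\<close>
  have min: "\<tau> f \<le> \<tau> y" if y: "y \<in> ?\<Gamma>" "0 < \<tau> y" for y
  proof (cases "\<tau> y \<le> 1")
    case True
    obtain z where "z \<in> ?\<Gamma>" "\<tau> z = \<tau> y" "norm (real_vec z) \<le> (\<Sum>j = 1..Suc m. norm (?V j))"
      unfolding \<tau>_def
      by (rule fundamental_domain_translate[OF len lin' \<tau>'1 \<tau>'0 y(1)])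
        (use y(2) True in \<open>auto simp: \<tau>_def\<close>)
    then have "z \<in> G" using y(2) True by (simp add: G_def)
    then show ?thesis using Min[of z] f(2) \<open>\<tau> z = \<tau> y\<close> by simp
  qed (use f1 in simp)
  have decomp: "\<exists>q c. y = q *s f + int_comb m c (edge \<alpha>)" if y: "y \<in> ?\<Gamma>" for y
  proof -
    define q where "q = \<lfloor>\<tau> y / \<tau> f\<rfloor>"
    have "y - q *s f \<in> ?\<Gamma>" using y f\<Gamma> by (simp add: cone_lattice_closed)
    \<comment> \<open>The remainder has height at least 0 and below \<open>\<tau> f\<close>, so
      minimality forces height 0.\<close>
    moreover have "\<tau> (y - q *s f) = 0"
    proof -
      have "of_int q \<le> \<tau> y / \<tau> f" "\<tau> y / \<tau> f < of_int q + 1"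
        unfolding q_def by linarith+
      then have "0 \<le> \<tau> (y - q *s f)" "\<tau> (y - q *s f) < \<tau> f"
        using fpos by (simp_all add: \<tau>_simps field_simps)
      then show ?thesis using min[OF \<open>y - q *s f \<in> ?\<Gamma>\<close>] by linarith
    qed
    ultimately obtain c where "y - q *s f = int_comb m c (edge \<alpha>)" using ker by blast
    then have "y = q *s f + int_comb m c (edge \<alpha>)" by (simp add: algebra_simps)
    then show ?thesis by blast
  qed
  let ?e = "(edge \<alpha>)(Suc m := f)"
  have comb: "int_comb (Suc m) c ?e = c (Suc m) *s f + int_comb m c (edge \<alpha>)" for c
    using int_comb_fun_upd[of m c "c (Suc m)"] by simp
  have "int_span (Suc m) ?e = ?\<Gamma>"
  proof (intro equalityI subsetI)
    fix y assume "y \<in> int_span (Suc m) ?e"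
    then show "y \<in> ?\<Gamma>"
      using f\<Gamma> edge_in_cone_lattice[OF len]
      by (auto simp: int_span_def intro!: int_comb_in_cone_lattice)
  next
    fix y assume "y \<in> ?\<Gamma>"
    then obtain q c where y: "y = q *s f + int_comb m c (edge \<alpha>)" using decomp by blast
    have "y = int_comb (Suc m) (c(Suc m := q)) ?e"
      unfolding y int_comb_fun_upd ..
    then show "y \<in> int_span (Suc m) ?e" unfolding int_span_def by blast
  qed
  moreover have "\<forall>i \<in> {1..Suc m}. c i = 0" if zero: "int_comb (Suc m) c ?e = 0" for c
  proof
    fix i assume i: "i \<in> {1..Suc m}"
    have "of_int (c (Suc m)) * \<tau> f = \<tau> (int_comb (Suc m) c ?e)"
      unfolding comb by (simp add: \<tau>_simps \<tau>0)
    \<comment> \<open>Scaling the zero vector by 0 yields \<open>\<tau> 0 = 0\<close>.\<close>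
    also have "\<dots> = 0" using \<tau>_simps(3)[of 0 0] unfolding zero by simp
    finally have ck: "c (Suc m) = 0" using fpos by simp
    show "c i = 0"
    proof (cases "i = Suc m")
      case False
      \<comment> \<open>Once the coefficient of \<open>f\<close> is gone, the functional dual to
        edge \<open>i\<close> isolates \<open>c i\<close>.\<close>
      obtain \<sigma> where lin: "linear \<sigma>" and \<sigma>1: "\<sigma> (?V i) = (1 :: real)"
        and \<sigma>0: "\<And>j. j \<in> {1..Suc m} - {i} \<Longrightarrow> \<sigma> (?V j) = 0"
        using dual_functional[OF cone i] by metis
      have im: "i \<in> {1..m}" using i False by auto
      have "0 = \<sigma> (real_vec (int_comb m c (edge \<alpha>)))"
        using zero unfolding comb ck by (simp add: real_vec_simps linear_0[OF lin])
      also have "\<dots> = (\<Sum>j = 1..m. of_int (c j) * \<sigma> (?V j))"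
        by (simp add: int_comb_def real_vec_sum real_vec_simps linear_sum[OF lin]
            linear_cmul[OF lin])
      also have "\<dots> = (\<Sum>j = 1..m. if j = i then of_int (c j) else 0)"
        by (intro sum.cong refl) (auto simp: \<sigma>1 \<sigma>0)
      also have "\<dots> = of_int (c i)" using im by simp
      finally show ?thesis by simp
    qed (use ck in simp)
  qed
  ultimately have basis: "int_basis (Suc m) ?e ?\<Gamma>" unfolding int_basis_def by blast
  obtain s b where sb: "edge \<alpha> (Suc m) = s *s f + int_comb m b (edge \<alpha>)"
    using decomp[OF edge_in_cone_lattice[OF len last]] by blast
  \<comment> \<open>Comparing heights shows that \<open>s\<close> is the reciprocal of the least
    positive height.\<close>
  have "1 = of_int s * \<tau> f"
    using \<tau>1 unfolding sb by (simp add: \<tau>_simps \<tau>0)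
  then have "0 < s" using fpos by (metis of_int_0_less_iff zero_less_mult_pos2 zero_less_one)
  then show ?thesis using that basis sb by blast
qed

section \<open>The last column of the normal form\<close>

text \<open>The first \<open>m\<close> edges are basis vectors, so their columns are unit columns.
  Absorbing the quotients \<open>b j div s\<close> into \<open>f\<close> leaves only remainders in
  the last column.\<close>

lemma iarctan_last_column:
  assumes len: "length (edges \<alpha>) = Suc m"
    and basis: "int_basis (Suc m) ((edge \<alpha>)(Suc m := f)) (cone_lattice \<alpha>)"
    and s: "0 < s" and sb: "edge \<alpha> (Suc m) = s *s f + int_comb m b (edge \<alpha>)"
  shows "lsin (Suc m) \<alpha> = s" and "\<And>j. j \<in> {1..m} \<Longrightarrow> lcos j (Suc m) \<alpha> = b j mod s"
proof -
  define e where "e = (edge \<alpha>)(Suc m := f + int_comb m (\<lambda>j. b j div s) (edge \<alpha>))"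
  define a where "a j i = (if 1 \<le> j \<and> j \<le> i \<and> i \<le> Suc m then
      if i = Suc m then if j = i then s else b j mod s else if j = i then 1 else 0 else 0)" for j i
  have e: "int_basis (Suc m) e (cone_lattice \<alpha>)"
  proof (rule int_basis_shear[OF basis, of "\<lambda>_. 1" _ "\<lambda>j. b j div s"])
    have "int_comb m (\<lambda>j. b j div s) ((edge \<alpha>)(Suc m := f)) = int_comb m (\<lambda>j. b j div s) (edge \<alpha>)"
      by (rule int_comb_cong) auto
    then show "e (Suc m) = 1 *s ((edge \<alpha>)(Suc m := f)) (Suc m) +
        int_comb m (\<lambda>j. b j div s) ((edge \<alpha>)(Suc m := f))"
      by (simp add: e_def)
  qed (auto simp: e_def)
  have "edge \<alpha> i = (\<Sum>j = 1..i. a j i *s e j)" if i: "i \<in> {1..Suc m}" for i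
  proof (cases "i = Suc m")
    case True
    have "(\<Sum>j = 1..Suc m. a j (Suc m) *s e j) = s *s e (Suc m) + int_comb m (\<lambda>j. a j (Suc m)) e"
      by (simp add: int_comb_def a_def)
    also have "int_comb m (\<lambda>j. a j (Suc m)) e = int_comb m (\<lambda>j. b j mod s) (edge \<alpha>)"
      by (rule int_comb_cong) (auto simp: a_def e_def)
    also have "s *s e (Suc m) + \<dots> = s *s f + int_comb m (\<lambda>j. s * (b j div s) + b j mod s) (edge \<alpha>)"
      by (simp only: e_def fun_upd_same vector_add_ldistrib int_comb_scale add.assoc int_comb_add)
    also have "\<dots> = edge \<alpha> (Suc m)" unfolding sb by simp
    finally show ?thesis unfolding True ..
  next
    case False
    have "(\<Sum>j = 1..i. a j i *s e j) = (\<Sum>j = 1..i. if j = i then e j else 0)"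
      using False i by (intro sum.cong) (auto simp: a_def)
    then show ?thesis using False i by (simp add: e_def)
  qed
  then have "is_iarctan \<alpha> a"
    unfolding is_iarctan_def Let_def len using e s
    by (intro exI[of _ e]) (auto simp: a_def)
  then have "iarctan \<alpha> = a" by (rule iarctan_eqI)
  then show "lsin (Suc m) \<alpha> = s" and "\<And>j. j \<in> {1..m} \<Longrightarrow> lcos j (Suc m) \<alpha> = b j mod s"
    by (auto simp: lsin_def lcos_def a_def)
qed

text \<open>Used in contrapositive form: if the last sine is not 1, no cosine in the last column
  vanishes. A vanishing one yields a lattice point \<open>g\<close> in the span of the facet without
  edge \<open>x\<close>. Expanding \<open>g\<close> integrally in that facet makes its
  \<open>f\<close>-coordinate, which is 1, a multiple of \<open>s\<close>.\<close>

lemma simple_cone_last_column_nonzero: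
  assumes cone: "ordered_rational_cone (Suc m) \<alpha>" and simple: "simple_cone \<alpha>"
    and basis: "int_basis (Suc m) ((edge \<alpha>)(Suc m := f)) (cone_lattice \<alpha>)"
    and s: "0 < s" and sb: "edge \<alpha> (Suc m) = s *s f + int_comb m b (edge \<alpha>)"
    and x: "x \<in> {1..m}" and zero: "b x mod s = 0"
  shows "s = 1"
proof -
  let ?V = "\<lambda>j. real_vec (edge \<alpha> j)" and ?e = "(edge \<alpha>)(Suc m := f)"
  obtain q where q: "b x = s * q" using zero by auto
  define g where "g = f + q *s edge \<alpha> x"
  have "int_comb m b (edge \<alpha>) = b x *s edge \<alpha> x + (\<Sum>j \<in> {1..m} - {x}. b j *s edge \<alpha> j)"
    unfolding int_comb_def using x by (subst sum.remove[of _ x]) auto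
  then have sg: "s *s g = edge \<alpha> (Suc m) - (\<Sum>j \<in> {1..m} - {x}. b j *s edge \<alpha> j)"
    by (simp add: g_def sb q vector_add_ldistrib vector_smult_assoc)
  have "real_vec (s *s g) \<in> span (?V ` ({1..Suc m} - {x}))"
    unfolding sg real_vec_simps real_vec_sum using x
    by (intro span_diff span_sum span_scale span_base) auto
  \<comment> \<open>Division by \<open>s\<close> is possible in the real span; simplicity then
    restores integer coefficients.\<close>
  then have "(1 / of_int s) *\<^sub>R real_vec (s *s g) \<in> span (?V ` ({1..Suc m} - {x}))"
    by (rule span_scale)
  moreover have "(1 / of_int s) *\<^sub>R real_vec (s *s g) = real_vec g"
    using s by (simp add: real_vec_simps)
  ultimately have g: "real_vec g \<in> span (?V ` ({1..Suc m} - {x}))" by simp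
  have "x \<in> {1..Suc m}" using x by simp
  from simple_cone_facet[OF cone simple this g]
  obtain c where c: "g = (\<Sum>j \<in> {1..Suc m} - {x}. c j *s edge \<alpha> j)" .
  \<comment> \<open>The coefficient 0 at \<open>x\<close> extends the facet expansion to all of the
    first \<open>m\<close> edges.\<close>
  define d where "d j = (if j \<in> {1..m} - {x} then c j else 0)" for j
  have "{1..Suc m} - {x} = insert (Suc m) ({1..m} - {x})" using x by auto
  then have "g = c (Suc m) *s edge \<alpha> (Suc m) + int_comb m d (edge \<alpha>)"
    unfolding c d_def by (subst int_comb_if_mem) auto
  also have "\<dots> = (c (Suc m) * s) *s f + int_comb m (\<lambda>j. c (Suc m) * b j + d j) (edge \<alpha>)"
    by (simp add: sb vector_add_ldistrib vector_smult_assoc int_comb_scale flip: int_comb_add)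
  also have "g = 1 *s f + int_comb m (\<lambda>j. if j = x then q else 0) (edge \<alpha>)"
    by (simp add: g_def int_comb_single[OF x])
  finally have "int_comb (Suc m) ((\<lambda>j. if j = x then q else 0)(Suc m := 1)) ?e =
      int_comb (Suc m) ((\<lambda>j. c (Suc m) * b j + d j)(Suc m := c (Suc m) * s)) ?e"
    unfolding int_comb_fun_upd .
  from int_basis_unique_coeffs[OF basis this, of "Suc m"] have "1 = c (Suc m) * s" by simp
  then have "s dvd 1" by (metis dvd_triv_right)
  then show ?thesis using s by simp
qed

section \<open>Adjacent cones\<close>

lemma edge_adjacent_cone:
  assumes "length (edges \<alpha>) = k" and "i \<in> {1..k}" and "j \<in> {1..k}"
  shows "edge (adjacent_cone i \<alpha>) j = (if j = i then - edge \<alpha> i else edge \<alpha> j)"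
  using assms by (auto simp: adjacent_cone_def edge_def nth_list_update)

lemma length_adjacent_cone: "length (edges (adjacent_cone i \<alpha>)) = length (edges \<alpha>)"
  by (simp add: adjacent_cone_def)

lemma cone_lattice_adjacent_cone:
  assumes len: "length (edges \<alpha>) = k" and i: "i \<in> {1..k}"
  shows "cone_lattice (adjacent_cone i \<alpha>) = cone_lattice \<alpha>"
proof -
  let ?V = "\<lambda>j. real_vec (edge \<alpha> j)" and ?W = "\<lambda>j. real_vec (edge (adjacent_cone i \<alpha>) j)"
  have W: "?W j = (if j = i then - ?V j else ?V j)" if "j \<in> {1..k}" for j
    using edge_adjacent_cone[OF len i that] by (simp add: real_vec_simps)
  have "?W j \<in> span (?V ` {1..k})" "?V j \<in> span (?W ` {1..k})" if j: "j \<in> {1..k}" for j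
  proof -
    have "?V j \<in> span (?V ` {1..k})" "?W j \<in> span (?W ` {1..k})"
      using j by (auto intro: span_base)
    then show "?W j \<in> span (?V ` {1..k})" "?V j \<in> span (?W ` {1..k})"
      using W[OF j] span_neg[of "?V j" "?V ` {1..k}"] span_neg[of "?W j" "?W ` {1..k}"]
      by (auto split: if_splits)
  qed
  then have "span (?W ` {1..k}) = span (?V ` {1..k})"
    by (intro span_eq[THEN iffD2]) auto
  then show ?thesis
    using cone_lattice_eq[OF len] cone_lattice_eq[of "adjacent_cone i \<alpha>" k]
    by (simp add: length_adjacent_cone len)
qed

text \<open>The data \<open>f\<close>, \<open>s\<close>, \<open>b\<close> carry over to the adjacent
  cone. If the last edge is reversed, \<open>f\<close> is reversed too, so that \<open>s\<close>
  stays positive; each \<open>b j\<close> acquires the product of the signs of the last edge and of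
  edge \<open>j\<close>.\<close>

lemma lcos_adjacent_cone:
  assumes len: "length (edges \<alpha>) = Suc m"
    and basis: "int_basis (Suc m) ((edge \<alpha>)(Suc m := f)) (cone_lattice \<alpha>)"
    and s: "0 < s" and sb: "edge \<alpha> (Suc m) = s *s f + int_comb m b (edge \<alpha>)"
    and i: "i \<in> {1..Suc m}" and x: "x \<in> {1..m}"
  shows "lcos x (Suc m) (adjacent_cone i \<alpha>) = (if i = Suc m \<or> x = i then - b x else b x) mod s"
proof -
  let ?\<beta> = "adjacent_cone i \<alpha>"
  define \<epsilon> :: "nat \<Rightarrow> int" where "\<epsilon> j = (if j = i then -1 else 1)" for j
  have \<epsilon>: "\<epsilon> j * \<epsilon> j = 1" for j by (simp add: \<epsilon>_def)
  have \<beta>: "edge ?\<beta> j = \<epsilon> j *s edge \<alpha> j" if "j \<in> {1..Suc m}" for j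
    using edge_adjacent_cone[OF len i that] by (simp add: \<epsilon>_def vector_sneg_minus1)
  have "int_basis (Suc m) ((edge ?\<beta>)(Suc m := \<epsilon> (Suc m) *s f)) (cone_lattice ?\<beta>)"
    unfolding cone_lattice_adjacent_cone[OF len i]
  \<comment> \<open>A pure change of signs, with zero shear.\<close>
  proof (rule int_basis_shear[OF basis, of \<epsilon> _ "\<lambda>_. 0"])
    show "((edge ?\<beta>)(Suc m := \<epsilon> (Suc m) *s f)) j = \<epsilon> j *s ((edge \<alpha>)(Suc m := f)) j"
      if "j \<in> {1..m}" for j
      using \<beta>[of j] that by simp
  qed (simp_all add: \<epsilon> int_comb_def)
  moreover have "edge ?\<beta> (Suc m) =
      s *s (\<epsilon> (Suc m) *s f) + int_comb m (\<lambda>j. \<epsilon> (Suc m) * \<epsilon> j * b j) (edge ?\<beta>)"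
  proof -
    have "int_comb m (\<lambda>j. \<epsilon> (Suc m) * \<epsilon> j * b j) (edge ?\<beta>) =
        int_comb m (\<lambda>j. \<epsilon> (Suc m) * b j) (edge \<alpha>)"
      by (rule int_comb_cong) (simp add: \<beta> \<epsilon>_def vector_smult_assoc)
    then show ?thesis
      using \<beta>[of "Suc m"]
      by (simp add: sb vector_add_ldistrib vector_smult_assoc int_comb_scale mult.commute)
  qed
  ultimately have "lcos x (Suc m) ?\<beta> = \<epsilon> (Suc m) * \<epsilon> x * b x mod s"
    using iarctan_last_column(2)[of ?\<beta> m, OF _ _ s _ x] length_adjacent_cone[of i \<alpha>] len by simp
  then show ?thesis using x by (auto simp: \<epsilon>_def)
qed

text \<open>The condition that the sine differs from 1 accompanies exactly the cases where a cosine
  is reflected. For sine 1 all cosines in the last column are residues modulo 1, hence 0 in both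
  cones, whereas sine minus cosine would be 1.\<close>

theorem proposition3p14:
  fixes \<alpha> :: "'n::finite ordered_cone" and k :: nat
  assumes "ordered_rational_cone k \<alpha>" and "simple_cone \<alpha>"
  shows "(\<forall>i \<in> {1..k - 1}. \<forall>x \<in> {1..k - 1}. (x = i \<longrightarrow> lsin k \<alpha> \<noteq> 1) \<longrightarrow>
           lcos x k (adjacent_cone i \<alpha>) =
             (if x = i then lsin k \<alpha> - lcos x k \<alpha> else lcos x k \<alpha>)) \<and>
         (lsin k \<alpha> \<noteq> 1 \<longrightarrow>
           (\<forall>x \<in> {1..k - 1}. lcos x k (adjacent_cone k \<alpha>) = lsin k \<alpha> - lcos x k \<alpha>))"
proof (cases k)
  case (Suc m)
  have cone: "ordered_rational_cone (Suc m) \<alpha>" using assms(1) Suc by simp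
  then have len: "length (edges \<alpha>) = Suc m" unfolding ordered_rational_cone_def by simp
  obtain f s b where basis: "int_basis (Suc m) ((edge \<alpha>)(Suc m := f)) (cone_lattice \<alpha>)"
    and s: "0 < s" and sb: "edge \<alpha> (Suc m) = s *s f + int_comb m b (edge \<alpha>)"
    using simple_cone_basis[OF cone assms(2)] by metis
  note column = iarctan_last_column[OF len basis s sb]
  note adjacent = lcos_adjacent_cone[OF len basis s sb]
  \<comment> \<open>Negation sends a nonzero residue \<open>r\<close> to \<open>s - r\<close>; the
    residue 0 is excluded by simplicity.\<close>
  have neg: "(- b x) mod s = s - b x mod s" if "x \<in> {1..m}" "s \<noteq> 1" for x
    using simple_cone_last_column_nonzero[OF cone assms(2) basis s sb that(1)] that(2)
    by (auto simp: zmod_zminus1_eq_if)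
  show ?thesis
    unfolding Suc diff_Suc_1 column(1) by (auto simp: column(2) adjacent neg)
\<comment> \<open>For \<open>k = 0\<close> the index ranges are empty.\<close>
qed simp

end
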